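(* Let $\mathcal{S}_{\mathrm{E}}$ be the infinite-state traffic model of the mixed PETC/periodic (MPETC) system and $\mathcal{S}^{\mathrm{B}}$ the finite MPETC traffic model, both as defined in the context. Assume: (A1) the PETC system is globally exponentially stable (GES), and $a$ is a constant with $0<a<1$ such that every solution of the PETC system satisfies $V(\xi(t_{i+1}))\le aV(\xi(t_i))$ for all $i\in\mathbb{N}_0$; (A2) $h_{\mathrm{P}}>0$ is such that under the periodic sampling $t_{i+1}=t_i+h_{\mathrm{P}}$ every solution of the plant satisfies $V(\xi(t_{i+1}))\le V(\xi(t_i))$; (A3) $V_0>0$ and initial states lie in $\mathcal{X}_0=\{x\in\mathbb{R}^{n_x}: V(x)\le V_0\}$. Let $0<r<1$ and $N:=\lceil\log_a(r)\rceil$. Then $\mathcal{S}_{\mathrm{E}}$ and $\mathcal{S}^{\mathrm{B}}$ are bisimilar, $\mathcal{S}_{\mathrm{E}}\cong\mathcal{S}^{\mathrm{B}}$.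
   Context: Plant and PETC. Let $A\in\mathbb{R}^{n_x\times n_x}$, $B\in\mathbb{R}^{n_x\times n_u}$, $K_{\mathrm{c}}\in\mathbb{R}^{n_u\times n_x}$, $h>0$, $\bar k\in\mathbb{N}$ ($\bar k\ge 1$), and let $Q\in\mathbb{R}^{2n_x\times 2n_x}$ be symmetric. The plant is $\dot\xi(t)=A\xi(t)+BK_{\mathrm{c}}\hat\xi(t)$, $\xi(0)=\hat\xi(0)=x_0$, with zero-order hold $\hat\xi(t)=\xi(t_i)$ for $t\in[t_i,t_{i+1})$, $t_0=0$. For $k\in\mathbb{N}$ put $M(k)=e^{Ahk}+\int_0^{hk}e^{A\tau}\,d\tau\,BK_{\mathrm{c}}$ and $N(k)=\begin{bmatrix}M(k)\\ I\end{bmatrix}^{\mathsf T}Q\begin{bmatrix}M(k)\\ I\end{bmatrix}$. The discrete inter-event time is $\kappa(x)=\min\{k\in\{1,\dots,\bar k\}: x^{\mathsf T}N(k)x>0\text{ or }k=\bar k\}$. The PETC system is the plant with $t_{i+1}=t_i+h\kappa(\xi(t_i))$. It is GES if there are $M<\infty$, $b>0$ such that $|\xi(t)|\le Me^{-bt}|\xi(0)|$ for all $t\ge0$ and all initial states. $V(x)=x^{\mathsf T}Px$ with $P$ symmetric positive definite. $\underline{k}:=\min\{k\in\{1,\dots,\bar k\}: N(k)\text{ is not negative semidefinite}\}$ (and $\underline k:=\bar k$ if there is no such $k$); $K:=\{\underline k,\underline k+1,\dots,\bar k\}$. MPETC. $\mathcal{X}_0:=\{x:V(x)\le V_0\}$,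 $\mathcal{X}_{\mathrm{P}}:=\{x: V(x)\le rV_0\}$. The MPETC uses $t_{i+1}=t_i+h\kappa(\xi(t_i))$ if $V(\xi(t_i))>rV_0$ and $t_{i+1}=t_i+h_{\mathrm{P}}$ if $V(\xi(t_i))\le rV_0$. Transition systems. An (autonomous) system is a tuple $(\mathcal{X},\mathcal{X}_0,\mathcal{E},\mathcal{Y},H)$ of states, initial states $\mathcal{X}_0\subseteq\mathcal{X}$, transitions $\mathcal{E}\subseteq\mathcal{X}\times\mathcal{X}$, outputs, and output map $H:\mathcal{X}\to\mathcal{Y}$. For systems $\mathcal{S}_a,\mathcal{S}_b$ with $\mathcal{Y}_a=\mathcal{Y}_b$, a relation $\mathcal{R}\subseteq\mathcal{X}_a\times\mathcal{X}_b$ is a simulation relation from $\mathcal{S}_a$ to $\mathcal{S}_b$ if (i) every $x_{a0}\in\mathcal{X}_{a0}$ is related to some $x_{b0}\in\mathcal{X}_{b0}$; (ii) $(x_a,x_b)\in\mathcal{R}$ implies $H_a(x_a)=H_b(x_b)$; (iii) if $(x_a,x_b)\in\mathcal{R}$ and $(x_a,x_a')\in\mathcal{E}_a$, there is $(x_b,x_b')\in\mathcal{E}_b$ with $(x_a',x_b')\in\mathcal{R}$. $\mathcal{S}_a\cong\mathcal{S}_b$ (bisimilar) if there is a relation $\mathcal{R}$ that is a simulation relation from $\mathcal{S}_a$ to $\mathcal{S}_b$ and whose inverse $\mathcal{R}^{-1}$ is a simulation relation from $\mathcal{S}_b$ to $\mathcal{S}_a$. Model $\mathcal{S}_{\mathrm{E}}$: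 state set and initial state set both $\mathcal{X}=\mathcal{X}_0$; transitions $\mathcal{E}_{\mathrm{PETC}}\cup\mathcal{E}_{\mathrm{P}}$ with $\mathcal{E}_{\mathrm{PETC}}=\{(x,x')\in(\mathcal{X}\setminus\mathcal{X}_{\mathrm{P}})\times\mathcal{X}: x'=M(\kappa(x))x\}$ and $\mathcal{E}_{\mathrm{P}}=\{(x,x')\in\mathcal{X}_{\mathrm{P}}\times\mathcal{X}_{\mathrm{P}}: x'=(e^{Ah_{\mathrm{P}}}+\int_0^{h_{\mathrm{P}}}e^{A\tau}d\tau\,BK_{\mathrm{c}})x\}$; outputs $\mathcal{Y}_{\mathrm{E}}=\{h,2h,\dots,\bar kh,h_{\mathrm{P}}\}$; $H_{\mathrm{E}}(x)=h\kappa(x)$ for $x\in\mathcal{X}\setminus\mathcal{X}_{\mathrm{P}}$ and $H_{\mathrm{E}}(x)=h_{\mathrm{P}}$ for $x\in\mathcal{X}_{\mathrm{P}}$. Model $\mathcal{S}^{\mathrm{B}}$: let $K^m$ be the set of sequences of length $m$ with entries in $K$, $\varepsilon$ the empty sequence, $\mathbb{K}_N:=\bigcup_{i=1}^NK^i\cup\{\varepsilon\}$. Let $\mathcal{K}_k=\{x\in\mathcal{X}:x^{\mathsf T}N(k)x>0\}$ for $k<\bar k$, $\mathcal{K}_{\bar k}=\mathcal{X}$, and $\mathcal{Q}_k=\mathcal{K}_k\cap\bigcap_{j=\underline k}^{k-1}(\mathcal{X}\setminus\mathcal{K}_j)$ (just $\mathcal{K}_k$ if $k=\underline k$). Define $\mathcal{R}_{\mathrm{B}}\subseteq\mathcal{X}\times\mathbb{K}_N$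 by: $(x,\varepsilon)\in\mathcal{R}_{\mathrm{B}}$ iff $x\in\mathcal{X}_{\mathrm{P}}$; and for $m\ge1$, $(x,k_1k_2\cdots k_m)\in\mathcal{R}_{\mathrm{B}}$ iff $x\in\mathcal{X}_0$, $x\in\mathcal{Q}_{k_1}$, $M(k_{i-1})\cdots M(k_1)x\in\mathcal{Q}_{k_i}$ for $i=2,\dots,m$, $x\notin\mathcal{X}_{\mathrm{P}}$, $M(k_i)\cdots M(k_1)x\notin\mathcal{X}_{\mathrm{P}}$ for $i=1,\dots,m-1$, and $M(k_m)\cdots M(k_1)x\in\mathcal{X}_{\mathrm{P}}$. Let $\mathcal{X}^{\mathrm{B}}:=\{\sigma\in\mathbb{K}_N:(x,\sigma)\in\mathcal{R}_{\mathrm{B}}\text{ for some }x\in\mathcal{X}\}$. $\mathcal{S}^{\mathrm{B}}$ has state set and initial state set $\mathcal{X}^{\mathrm{B}}$; transitions all pairs in $\mathcal{X}^{\mathrm{B}}\times\mathcal{X}^{\mathrm{B}}$ of the form $(k\sigma,\sigma)$ with $k\in K$, together with $(\varepsilon,\varepsilon)$; output set $\mathcal{Y}_{\mathrm{E}}$; output map $H^{\mathrm{S}}(k\sigma)=hk$, $H^{\mathrm{S}}(\varepsilon)=h_{\mathrm{P}}$. *)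

theory Defs
  imports "HOL-Analysis.Analysis"
begin

record ('s, 'o) tsystem =
  states :: "'s set"
  initial :: "'s set"
  transitions :: "('s \<times> 's) set"
  outputs :: "'o set"
  outmap :: "'s \<Rightarrow> 'o"

definition wf_tsystem :: "('s, 'o) tsystem \<Rightarrow> bool" where
  "wf_tsystem S \<longleftrightarrow>
     initial S \<subseteq> states S \<and> transitions S \<subseteq> states S \<times> states S \<and>
     outmap S ` states S \<subseteq> outputs S"

definition simulation_relation ::
  "('s \<times> 't) set \<Rightarrow> ('s, 'o) tsystem \<Rightarrow> ('t, 'o) tsystem \<Rightarrow> bool" where
  "simulation_relation R Sa Sb \<longleftrightarrow>
     R \<subseteq> states Sa \<times> states Sb \<and>
     (\<forall>xa\<in>initial Sa. \<exists>xb\<in>initial Sb. (xa, xb) \<in> R) \<and>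
     (\<forall>(xa, xb)\<in>R. outmap Sa xa = outmap Sb xb) \<and>
     (\<forall>(xa, xb)\<in>R. \<forall>xa'. (xa, xa') \<in> transitions Sa \<longrightarrow>
        (\<exists>xb'. (xb, xb') \<in> transitions Sb \<and> (xa', xb') \<in> R))"

definition bisimilar :: "('s, 'o) tsystem \<Rightarrow> ('t, 'o) tsystem \<Rightarrow> bool" where
  "bisimilar Sa Sb \<longleftrightarrow>
     outputs Sa = outputs Sb \<and>
     (\<exists>R. simulation_relation R Sa Sb \<and> simulation_relation (R\<inverse>) Sb Sa)"

text \<open>The type \<^typ>\<open>real^'n^'n\<close> carries the componentwise product, so the
  library's \<^const>\<open>exp\<close> is not the matrix exponential; its power series is used.\<close>

definition mat_exp :: "real^'n^'n \<Rightarrow> real^'n^'n" where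
  "mat_exp A = (\<Sum>k. (1 / fact k) *\<^sub>R (((**) A ^^ k) (mat 1)))"

definition vstack :: "real^'n^'m \<Rightarrow> real^'n^'l \<Rightarrow> real^'n^('m + 'l)" where
  "vstack C D = (\<chi> i. case i of Inl j \<Rightarrow> C $ j | Inr j \<Rightarrow> D $ j)"

definition pos_definite :: "real^'n^'n \<Rightarrow> bool" where
  "pos_definite P \<longleftrightarrow> transpose P = P \<and> (\<forall>x. x \<noteq> 0 \<longrightarrow> x \<bullet> (P *v x) > 0)"

definition neg_semidefinite :: "real^'n^'n \<Rightarrow> bool" where
  "neg_semidefinite P \<longleftrightarrow> transpose P = P \<and> (\<forall>x. x \<bullet> (P *v x) \<le> 0)"

context
  fixes A :: "real^'nx^'nx"
    and B :: "real^'nu^'nx"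
    and Kc :: "real^'nx^'nu"
begin

text \<open>\<open>t\<close> are the sampling times and \<open>\<tau> x\<close> is the time to the next sample when the
  sampled state is \<open>x\<close>. On \<open>[t i, t (Suc i))\<close> the held state is \<open>\<xi> (t i)\<close>. The derivative is
  one-sided at \<open>t i\<close>, where the input jumps, and two-sided between samples.\<close>

definition sampled_solution ::
  "(real^'nx \<Rightarrow> real) \<Rightarrow> (real \<Rightarrow> real^'nx) \<Rightarrow> (nat \<Rightarrow> real) \<Rightarrow> bool" where
  "sampled_solution \<tau> \<xi> t \<longleftrightarrow>
     t 0 = 0 \<and> (\<forall>i. t (Suc i) = t i + \<tau> (\<xi> (t i))) \<and>
     continuous_on {0..} \<xi> \<and>
     (\<forall>i. \<forall>s\<in>{t i..<t (Suc i)}.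
        (\<xi> has_vector_derivative (A *v \<xi> s + (B ** Kc) *v \<xi> (t i)))
          (at s within {t i..<t (Suc i)}))"

definition transition_mat :: "real \<Rightarrow> real^'nx^'nx" where
  "transition_mat T =
     mat_exp (T *\<^sub>R A) + integral {0..T} (\<lambda>\<tau>. mat_exp (\<tau> *\<^sub>R A)) ** (B ** Kc)"

context
  fixes h :: real
    and kbar :: nat
    and Q :: "real^('nx + 'nx)^('nx + 'nx)"
begin

definition Mmat :: "nat \<Rightarrow> real^'nx^'nx" where
  "Mmat k = transition_mat (h * real k)"

definition Nmat :: "nat \<Rightarrow> real^'nx^'nx" where
  "Nmat k = transpose (vstack (Mmat k) (mat 1)) ** Q ** vstack (Mmat k) (mat 1)"

definition kappa :: "real^'nx \<Rightarrow> nat" where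
  "kappa x = Min {k \<in> {1..kbar}. x \<bullet> (Nmat k *v x) > 0 \<or> k = kbar}"

definition petc_solution :: "(real \<Rightarrow> real^'nx) \<Rightarrow> (nat \<Rightarrow> real) \<Rightarrow> bool" where
  "petc_solution = sampled_solution (\<lambda>x. h * real (kappa x))"

definition petc_GES :: bool where
  "petc_GES \<longleftrightarrow>
     (\<exists>M b. b > 0 \<and>
        (\<forall>\<xi> t. petc_solution \<xi> t \<longrightarrow> (\<forall>s\<ge>0. norm (\<xi> s) \<le> M * exp (- b * s) * norm (\<xi> 0))))"

definition kmin :: nat where
  "kmin = (if \<exists>k\<in>{1..kbar}. \<not> neg_semidefinite (Nmat k)
           then Min {k \<in> {1..kbar}. \<not> neg_semidefinite (Nmat k)} else kbar)"

definition Kset :: "nat set" where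
  "Kset = {kmin..kbar}"

context
  fixes P :: "real^'nx^'nx"
    and V0 r hP :: real
begin

definition V :: "real^'nx \<Rightarrow> real" where
  "V x = x \<bullet> (P *v x)"

definition X0 :: "(real^'nx) set" where
  "X0 = {x. V x \<le> V0}"

definition XP :: "(real^'nx) set" where
  "XP = {x. V x \<le> r * V0}"

definition YE :: "real set" where
  "YE = (\<lambda>k. h * real k) ` {1..kbar} \<union> {hP}"

definition E_petc :: "((real^'nx) \<times> (real^'nx)) set" where
  "E_petc = {(x, x') \<in> (X0 - XP) \<times> X0. x' = Mmat (kappa x) *v x}"

definition E_per :: "((real^'nx) \<times> (real^'nx)) set" where
  "E_per = {(x, x') \<in> XP \<times> XP. x' = transition_mat hP *v x}"

definition S_E :: "(real^'nx, real) tsystem" where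
  "S_E = \<lparr>states = X0, initial = X0, transitions = E_petc \<union> E_per, outputs = YE,
          outmap = (\<lambda>x. if x \<in> XP then hP else h * real (kappa x))\<rparr>"

definition K_region :: "nat \<Rightarrow> (real^'nx) set" where
  "K_region k = (if k < kbar then {x \<in> X0. x \<bullet> (Nmat k *v x) > 0} else X0)"

definition Q_region :: "nat \<Rightarrow> (real^'nx) set" where
  "Q_region k = K_region k - (\<Union>j\<in>{kmin..<k}. K_region j)"

text \<open>\<open>run \<sigma> x\<close> is \<open>M(k_m) \<dots> M(k_1) x\<close> for \<open>\<sigma> = [k_1, \<dots>, k_m]\<close>.\<close>

definition run :: "nat list \<Rightarrow> real^'nx \<Rightarrow> real^'nx" where
  "run \<sigma> x = fold (\<lambda>k y. Mmat k *v y) \<sigma> x"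

context
  fixes N :: nat
begin

definition K_seqs :: "nat list set" where
  "K_seqs = (\<Union>i\<in>{1..N}. {\<sigma>. length \<sigma> = i \<and> set \<sigma> \<subseteq> Kset}) \<union> {[]}"

text \<open>With the 0-based indexing of lists, \<open>\<sigma> ! i\<close> is \<open>k_(i+1)\<close>; the two conditions on all
  \<open>i < length \<sigma>\<close> include, for \<open>i = 0\<close>, those on \<open>x\<close> itself.\<close>

definition RB :: "((real^'nx) \<times> nat list) set" where
  "RB = {(x, \<sigma>) \<in> X0 \<times> K_seqs.
     if \<sigma> = [] then x \<in> XP
     else (\<forall>i<length \<sigma>. run (take i \<sigma>) x \<in> Q_region (\<sigma> ! i)) \<and>
          (\<forall>i<length \<sigma>. run (take i \<sigma>) x \<notin> XP) \<and>
          run \<sigma> x \<in> XP}"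

definition XB :: "nat list set" where
  "XB = {\<sigma> \<in> K_seqs. \<exists>x\<in>X0. (x, \<sigma>) \<in> RB}"

definition S_B :: "(nat list, real) tsystem" where
  "S_B = \<lparr>states = XB, initial = XB,
          transitions = {(\<sigma>', \<sigma>) \<in> XB \<times> XB. (\<exists>k\<in>Kset. \<sigma>' = k # \<sigma>) \<or> \<sigma>' = [] \<and> \<sigma> = []},
          outputs = YE,
          outmap = (\<lambda>\<sigma>. case \<sigma> of [] \<Rightarrow> hP | k # _ \<Rightarrow> h * real k)\<rparr>"

end

end

end

end

lemma kappa_in: "1 \<le> kbar \<Longrightarrow> kappa A B Kc h kbar Q x \<in> {1..kbar}"
proof -
  assume "1 \<le> kbar"
  let ?S = "{k \<in> {1..kbar}. x \<bullet> (Nmat A B Kc h Q k *v x) > 0 \<or> k = kbar}"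
  have "Min ?S \<in> ?S"
    by (rule Min_in) (use \<open>1 \<le> kbar\<close> in auto)
  then show ?thesis
    unfolding kappa_def by blast
qed

lemma kmin_in: "1 \<le> kbar \<Longrightarrow> kmin A B Kc h kbar Q \<in> {1..kbar}"
proof -
  assume *: "1 \<le> kbar"
  let ?S = "{k \<in> {1..kbar}. \<not> neg_semidefinite (Nmat A B Kc h Q k)}"
  have S: "Min ?S \<in> ?S" if "?S \<noteq> {}"
    by (rule Min_in) (use that in auto)
  show ?thesis
  proof (cases "\<exists>k\<in>{1..kbar}. \<not> neg_semidefinite (Nmat A B Kc h Q k)")
    case True
    then have "Min ?S \<in> ?S"
      by (intro S) blast
    with True show ?thesis
      unfolding kmin_def if_P[OF True] by blast
  next
    case False
    with * show ?thesis
      unfolding kmin_def if_not_P[OF False] by simp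
  qed
qed

lemma XP_subset: "r < 1 \<Longrightarrow> 0 < V0 \<Longrightarrow> XP P V0 r \<subseteq> X0 P V0"
proof -
  assume "r < 1" "0 < V0"
  then have "r * V0 \<le> V0"
    by simp
  then show ?thesis
    by (auto simp: XP_def X0_def)
qed

lemma wf_S_E:
  assumes "1 \<le> kbar" "r < 1" "0 < V0"
  shows "wf_tsystem (S_E A B Kc h kbar Q P V0 r hP)"
proof -
  have "E_petc A B Kc h kbar Q P V0 r \<union> E_per A B Kc P V0 r hP \<subseteq> X0 P V0 \<times> X0 P V0"
    using XP_subset[OF assms(2,3), of P] unfolding E_petc_def E_per_def by blast
  moreover have "h * real (kappa A B Kc h kbar Q x) \<in> YE h kbar hP" for x
    using kappa_in[OF assms(1), of A B Kc h Q x] unfolding YE_def by blast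
  moreover have "hP \<in> YE h kbar hP"
    by (simp add: YE_def)
  ultimately show ?thesis
    by (simp add: wf_tsystem_def S_E_def image_subset_iff)
qed

lemma wf_S_B:
  assumes "1 \<le> kbar"
  shows "wf_tsystem (S_B A B Kc h kbar Q P V0 r hP N)"
proof -
  have "h * real k \<in> YE h kbar hP" if "k # \<sigma> \<in> XB A B Kc h kbar Q P V0 r N" for k \<sigma>
  proof -
    have "k \<in> Kset A B Kc h kbar Q"
      using that by (auto simp: XB_def K_seqs_def)
    then have "k \<in> {1..kbar}"
      using kmin_in[OF assms, of A B Kc h Q] by (auto simp: Kset_def)
    then show ?thesis
      unfolding YE_def by blast
  qed
  moreover have "hP \<in> YE h kbar hP"
    by (simp add: YE_def)
  ultimately show ?thesis
    by (auto simp: wf_tsystem_def S_B_def split: list.splits)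
qed

end

(* The relation R_B is itself the bisimulation: on X_0 the region Q_k is exactly the set
   kappa = k, so a state has precisely one related word, the list of inter-event times until it
   enters X_P. Such a word exists and has length at most N because V shrinks by the factor a per
   step and a^N <= r. The hypotheses on V speak about continuous-time solutions; to transfer them
   to the matrices M(k), a solution through any initial state is glued together from the pieces
   s |-> M(s - t_i) xi(t_i), using M' = A M + B K_c. *)

theory Submission
  imports Defs
begin

subsection \<open>The matrix exponential and the transition matrix\<close>

text \<open>The basis vectors of the product space are \<open>axis i u\<close>, and the inner
  product with \<open>axis i u\<close> sees only the i-th component. For matrices the rule is
  applied twice, first by rows and then by entries.\<close>

lemma has_vector_derivative_vecI:
  fixes f :: "real \<Rightarrow> ('a::euclidean_space)^'n"
  assumes "\<And>i. ((\<lambda>s. f s $ i) has_vector_derivative D $ i) (at s within S)"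
  shows "(f has_vector_derivative D) (at s within S)"
proof -
  have "((\<lambda>s. f s \<bullet> axis i u) has_derivative (\<lambda>c. (c *\<^sub>R D) \<bullet> axis i u)) (at s within S)" for i u
    unfolding inner_axis
    using bounded_linear.has_derivative[OF bounded_linear_inner_left
        assms[unfolded has_vector_derivative_def, of i], of u]
    by simp
  then show ?thesis
    unfolding has_vector_derivative_def
    by (subst has_derivative_componentwise_within) (auto simp: Basis_vec_def)
qed

lemma matrix_add_rdistrib: "(A + B) ** C = A ** C + B ** C"
  for A B :: "'a::semiring_1^'n^'m"
  by (simp add: matrix_matrix_mult_def vec_eq_iff distrib_right sum.distrib)

lemma bounded_linear_matrix_mult_left: "bounded_linear (\<lambda>X::real^'k^'n. A ** X)"
  for A :: "real^'n^'m"
  by (intro linear_conv_bounded_linear[THEN iffD1] linearI)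
     (simp_all add: matrix_add_ldistrib matrix_scalar_ac scalar_matrix_assoc)

lemma bounded_linear_matrix_mult_right: "bounded_linear (\<lambda>X::real^'n^'m. X ** C)"
  for C :: "real^'k^'n"
  by (intro linear_conv_bounded_linear[THEN iffD1] linearI)
     (simp_all add: matrix_add_rdistrib scalar_matrix_assoc)

lemma bounded_linear_matrix_vector_mult: "bounded_linear (\<lambda>X::real^'n^'m. X *v x)"
  by (intro linear_conv_bounded_linear[THEN iffD1] linearI)
     (simp_all add: matrix_vector_mult_add_rdistrib scaleR_matrix_vector_assoc)

lemma matrix_power_scaleR:
  "((**) (s *\<^sub>R A) ^^ k) (mat 1) = s ^ k *\<^sub>R ((**) A ^^ k) (mat 1)" for A :: "real^'n^'n"
  by (induction k) (simp_all add: matrix_scalar_ac scalar_matrix_assoc[symmetric])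

text \<open>Dominated by the scalar exponential series of C, the operator norm of left
  multiplication by A: the k-th power has norm at most C^k times the norm of the identity.\<close>

lemma summable_mat_exp:
  "summable (\<lambda>k. (1 / fact k) *\<^sub>R ((**) A ^^ k) (mat 1))" for A :: "real^'n^'n"
proof -
  let ?C = "onorm ((**) A :: real^'n^'n \<Rightarrow> real^'n^'n)"
  have bl: "bounded_linear ((**) A :: real^'n^'n \<Rightarrow> real^'n^'n)"
    using bounded_linear_matrix_mult_left .
  have pow: "norm (((**) A ^^ k) (mat 1)) \<le> ?C ^ k * norm (mat 1 :: real^'n^'n)" for k
  proof (induction k)
    case (Suc k)
    have "norm (((**) A ^^ Suc k) (mat 1)) \<le> ?C * norm (((**) A ^^ k) (mat 1))"
      using onorm[OF bl] by simp
    also have "\<dots> \<le> ?C * (?C ^ k * norm (mat 1 :: real^'n^'n))"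
      by (intro mult_left_mono Suc onorm_pos_le bl)
    finally show ?case by simp
  qed simp
  have "summable (\<lambda>k. (inverse (fact k) * ?C ^ k) * norm (mat 1 :: real^'n^'n))"
    by (intro summable_mult2 summable_exp)
  then show ?thesis
    by (rule summable_comparison_test')
       (use pow in \<open>simp add: field_simps\<close>)
qed

text \<open>Pulling s^k out of each term makes every entry a scalar power series in s, to which
  termwise differentiation applies.\<close>

lemma mat_exp_nth:
  "mat_exp (s *\<^sub>R A) $ i $ j = (\<Sum>k. ((((**) A ^^ k) (mat 1)) $ i $ j / fact k) * s ^ k)"
  and summable_mat_exp_nth:
  "summable (\<lambda>k. ((((**) A ^^ k) (mat 1)) $ i $ j / fact k) * s ^ k)" for A :: "real^'n^'n"
proof -
  have bl: "bounded_linear (\<lambda>X::real^'n^'n. X $ i $ j)"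
    by (intro bounded_linear_compose[OF bounded_linear_vec_nth bounded_linear_vec_nth])
  have eq: "(1 / fact k) *\<^sub>R (((**) (s *\<^sub>R A) ^^ k) (mat 1)) $ i $ j
      = ((((**) A ^^ k) (mat 1)) $ i $ j / fact k) * s ^ k" for k
    by (simp add: matrix_power_scaleR)
  show "mat_exp (s *\<^sub>R A) $ i $ j = (\<Sum>k. ((((**) A ^^ k) (mat 1)) $ i $ j / fact k) * s ^ k)"
    unfolding mat_exp_def
    using bounded_linear.suminf[OF bl summable_mat_exp[of "s *\<^sub>R A"]] eq by simp
  show "summable (\<lambda>k. ((((**) A ^^ k) (mat 1)) $ i $ j / fact k) * s ^ k)"
    using bounded_linear.summable[OF bl summable_mat_exp[of "s *\<^sub>R A"]] eq by simp
qed

lemma mat_exp_has_vector_derivative: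
  "((\<lambda>s. mat_exp (s *\<^sub>R A)) has_vector_derivative A ** mat_exp (s *\<^sub>R A)) (at s within S)"
  for A :: "real^'n^'n"
proof (intro has_vector_derivative_vecI)
  fix i j
  let ?c = "\<lambda>i k. (((**) A ^^ k) (mat 1)) $ i $ j / fact k"
  have "((\<lambda>s. \<Sum>k. ?c i k * s ^ k) has_field_derivative (\<Sum>k. diffs (?c i) k * s ^ k)) (at s)"
    by (rule termdiffs_strong_converges_everywhere) (rule summable_mat_exp_nth)
  moreover have "(\<Sum>k. diffs (?c i) k * s ^ k) = (A ** mat_exp (s *\<^sub>R A)) $ i $ j"
  proof -
    \<comment> \<open>\<open>diffs\<close> shifts the series: its k-th coefficient is (k+1)
      (A^(k+1))_ij / (k+1)! = (A A^k)_ij / k!, expanded as a row-by-column sum.\<close>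
    have "diffs (?c i) k = (\<Sum>l\<in>UNIV. A $ i $ l * ?c l k)" for k
      by (simp add: diffs_def matrix_matrix_mult_def sum_divide_distrib[symmetric] del: of_nat_Suc)
    then have "diffs (?c i) k * s ^ k = (\<Sum>l\<in>UNIV. A $ i $ l * (?c l k * s ^ k))" for k
      by (simp add: sum_distrib_right mult.assoc)
    then have "(\<Sum>k. diffs (?c i) k * s ^ k) = (\<Sum>k. \<Sum>l\<in>UNIV. A $ i $ l * (?c l k * s ^ k))"
      by (rule suminf_cong)
    also have "\<dots> = (\<Sum>l\<in>UNIV. \<Sum>k. A $ i $ l * (?c l k * s ^ k))"
      by (intro suminf_sum summable_mult summable_mat_exp_nth)
    also have "\<dots> = (\<Sum>l\<in>UNIV. A $ i $ l * (\<Sum>k. ?c l k * s ^ k))"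
      by (intro sum.cong refl suminf_mult summable_mat_exp_nth)
    also have "\<dots> = (A ** mat_exp (s *\<^sub>R A)) $ i $ j"
      by (simp add: matrix_matrix_mult_def mat_exp_nth)
    finally show ?thesis .
  qed
  ultimately show "((\<lambda>s. mat_exp (s *\<^sub>R A) $ i $ j) has_vector_derivative
      (A ** mat_exp (s *\<^sub>R A)) $ i $ j) (at s within S)"
    by (simp add: mat_exp_nth has_real_derivative_iff_has_vector_derivative
        has_vector_derivative_at_within)
qed

lemma continuous_on_mat_exp: "continuous_on S (\<lambda>s. mat_exp (s *\<^sub>R A))" for A :: "real^'n^'n"
  by (rule continuous_on_vector_derivative) (rule mat_exp_has_vector_derivative)

lemma mat_exp_0: "mat_exp 0 = (mat 1 :: real^'n^'n)"
proof -
  have "(1 / fact k) *\<^sub>R ((**) (0 :: real^'n^'n) ^^ k) (mat 1) = (if k = 0 then mat 1 else 0)" for k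
    by (cases k) simp_all
  then show ?thesis
    unfolding mat_exp_def
    using sums_unique[OF sums_If_finite_set[of "{0}" "\<lambda>_. mat 1 :: real^'n^'n"]] by simp
qed

text \<open>Fundamental theorem of calculus for the matrix exponential, with the constant factor A
  taken out of the integral by linearity.\<close>

lemma mat_exp_integral:
  fixes A :: "real^'n^'n"
  assumes "0 \<le> s"
  shows "A ** integral {0..s} (\<lambda>\<tau>. mat_exp (\<tau> *\<^sub>R A)) = mat_exp (s *\<^sub>R A) - mat 1"
proof -
  have "((\<lambda>\<tau>. A ** mat_exp (\<tau> *\<^sub>R A)) has_integral mat_exp (s *\<^sub>R A) - mat_exp (0 *\<^sub>R A)) {0..s}"
    by (intro fundamental_theorem_of_calculus assms mat_exp_has_vector_derivative)
  moreover have "A ** integral {0..s} (\<lambda>\<tau>. mat_exp (\<tau> *\<^sub>R A))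
      = integral {0..s} (\<lambda>\<tau>. A ** mat_exp (\<tau> *\<^sub>R A))"
    using integral_linear[OF integrable_continuous_real[OF continuous_on_mat_exp]
        bounded_linear_matrix_mult_left, of 0 s A A]
    by (simp add: o_def)
  ultimately show ?thesis
    by (simp add: integral_unique mat_exp_0)
qed

lemma transition_mat_0: "transition_mat A B Kc 0 = mat 1"
  by (simp add: transition_mat_def mat_exp_0)

text \<open>The derivative is taken relative to \<open>{0..b}\<close>, hence one-sided at 0: for s <
  0 the interval \<open>{0..s}\<close> is empty and the integral term vanishes.\<close>

lemma transition_mat_has_vector_derivative:
  assumes "s \<in> {0..b}"
  shows "(transition_mat A B Kc has_vector_derivative A ** transition_mat A B Kc s + B ** Kc)
           (at s within {0..b})"
proof -
  let ?G = "\<lambda>s. integral {0..s} (\<lambda>\<tau>. mat_exp (\<tau> *\<^sub>R A))"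
  have "(?G has_vector_derivative mat_exp (s *\<^sub>R A)) (at s within {0..b})"
    by (rule integral_has_vector_derivative[OF continuous_on_mat_exp assms])
  then have "((\<lambda>s. ?G s ** (B ** Kc)) has_vector_derivative mat_exp (s *\<^sub>R A) ** (B ** Kc))
      (at s within {0..b})"
    by (rule bounded_linear.has_vector_derivative[OF bounded_linear_matrix_mult_right])
  then have "(transition_mat A B Kc has_vector_derivative
      A ** mat_exp (s *\<^sub>R A) + mat_exp (s *\<^sub>R A) ** (B ** Kc)) (at s within {0..b})"
    unfolding transition_mat_def
    by (intro has_vector_derivative_add mat_exp_has_vector_derivative)
  \<comment> \<open>Trading the exponential for A times its integral plus the identity lets A factor
    out of the whole derivative.\<close>
  moreover have "mat_exp (s *\<^sub>R A) = A ** ?G s + mat 1"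
    using mat_exp_integral[of s A] assms by simp
  then have "mat_exp (s *\<^sub>R A) ** (B ** Kc) = A ** (?G s ** (B ** Kc)) + B ** Kc"
    by (simp add: matrix_add_rdistrib matrix_mul_assoc)
  ultimately show ?thesis
    by (simp add: transition_mat_def matrix_add_ldistrib algebra_simps)
qed

text \<open>One piece of a solution: the curve is x at s = a and obeys the plant equation with the
  input held at x. It is the previous derivative shifted in time.\<close>

lemma transition_mat_solution:
  assumes "s \<in> {a..b}"
  shows "((\<lambda>s. transition_mat A B Kc (s - a) *v x) has_vector_derivative
           A *v (transition_mat A B Kc (s - a) *v x) + (B ** Kc) *v x) (at s within {a..b})"
proof -
  have "((\<lambda>s. s - a) has_vector_derivative 1) (at s within {a..b})"
    by (auto intro!: derivative_eq_intros)
  moreover have "(transition_mat A B Kc has_vector_derivative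
      A ** transition_mat A B Kc (s - a) + B ** Kc) (at (s - a) within (\<lambda>s. s - a) ` {a..b})"
    using transition_mat_has_vector_derivative[of "s - a" "b - a"] assms by simp
  ultimately have "(transition_mat A B Kc \<circ> (\<lambda>s. s - a) has_vector_derivative
      1 *\<^sub>R (A ** transition_mat A B Kc (s - a) + B ** Kc)) (at s within {a..b})"
    by (rule vector_diff_chain_within)
  from bounded_linear.has_vector_derivative[OF bounded_linear_matrix_vector_mult this, of x]
  show ?thesis
    by (simp add: o_def matrix_vector_mult_add_rdistrib matrix_vector_mul_assoc)
qed

subsection \<open>Sampled solutions\<close>

text \<open>The pieces between consecutive samples are glued at the sampling times. The uniform
  lower bound \<delta> on the sampling intervals keeps these times from accumulating, so the pieces
  cover all s \<ge> 0.\<close>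

lemma sampled_solution_exists:
  assumes "0 < \<delta>" and \<tau>: "\<And>x. \<delta> \<le> \<tau> x"
  obtains \<xi> t where "sampled_solution A B Kc \<tau> \<xi> t"
    and "\<And>i. \<xi> (t i) = ((\<lambda>x. transition_mat A B Kc (\<tau> x) *v x) ^^ i) x0"
proof -
  let ?\<Phi> = "transition_mat A B Kc"
  define xs where "xs i = ((\<lambda>x. ?\<Phi> (\<tau> x) *v x) ^^ i) x0" for i
  define t where "t i = (\<Sum>j<i. \<tau> (xs j))" for i
  \<comment> \<open>For s \<ge> 0 this is the index of the sampling interval containing s.\<close>
  define idx where "idx s = (LEAST i. s < t (Suc i))" for s
  define \<xi> where "\<xi> s = ?\<Phi> (s - t (idx s)) *v xs (idx s)" for s
  have t0: "t 0 = 0" and tS: "t (Suc i) = t i + \<tau> (xs i)" for i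
    by (simp_all add: t_def)
  have "t i < t (Suc i)" for i
    using tS[of i] \<tau>[of "xs i"] \<open>0 < \<delta>\<close> by simp
  then have mono: "strict_mono t"
    by (rule strict_monoI_Suc)
  have t_ge: "\<delta> * real i \<le> t i" for i
  proof (induction i)
    case (Suc i)
    then show ?case using tS[of i] \<tau>[of "xs i"] by (simp add: algebra_simps)
  qed (simp add: t0)
  have idx: "idx s = i" if "s \<in> {t i..<t (Suc i)}" for s i
    unfolding idx_def
  proof (rule Least_equality)
    fix j assume "s < t (Suc j)"
    then have "t i < t (Suc j)" using that by simp
    then show "i \<le> j" using strict_mono_less[OF mono] by simp
  qed (use that in simp)
  have \<xi>_t: "\<xi> (t i) = xs i" for i
    using idx[of "t i" i] strict_mono_less[OF mono, of i "Suc i"]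
    by (simp add: \<xi>_def transition_mat_0)
  \<comment> \<open>The formula also holds at the right endpoint, because \<open>xs (Suc i)\<close>
    is defined as the end value of the piece before it. Closed intervals are what the pasting of
    continuity below needs.\<close>
  have piece: "\<xi> s = ?\<Phi> (s - t i) *v xs i" if "s \<in> {t i..t (Suc i)}" for s i
  proof (cases "s = t (Suc i)")
    case True
    then show ?thesis using \<xi>_t[of "Suc i"] tS[of i] by (simp add: xs_def)
  next
    case False
    then show ?thesis using idx[of s i] that by (simp add: \<xi>_def)
  qed
  have deriv: "(\<xi> has_vector_derivative A *v \<xi> s + (B ** Kc) *v \<xi> (t i)) (at s within {t i..t (Suc i)})"
    if "s \<in> {t i..t (Suc i)}" for s i
    unfolding \<xi>_t piece[OF that]
    by (rule has_vector_derivative_transform[OF that _ transition_mat_solution[OF that]])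
       (simp add: piece)
  have "continuous_on {0..t n} \<xi>" for n
  proof (induction n)
    case (Suc n)
    have "continuous_on {t n..t (Suc n)} \<xi>"
      by (rule continuous_on_vector_derivative) (rule deriv)
    with Suc have "continuous_on ({0..t n} \<union> {t n..t (Suc n)}) \<xi>"
      by (intro continuous_on_closed_Un) simp_all
    moreover have "0 \<le> t n" "t n \<le> t (Suc n)"
      using t_ge[of n] \<open>0 < \<delta>\<close> strict_mono_less[OF mono, of n "Suc n"]
      by (auto intro: order_trans[OF _ t_ge[of n]])
    ultimately show ?case
      by (simp add: ivl_disj_un_two_touch)
  qed (simp add: t0)
  then have "continuous (at s within {0..}) \<xi>" if "0 \<le> s" for s
  proof -
    obtain n where n: "s < \<delta> * real n"
      using reals_Archimedean3[OF \<open>0 < \<delta>\<close>] by (metis mult.commute)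
    \<comment> \<open>Continuity is local: \<open>{..<t n}\<close> is an open neighbourhood of s on
      which both domains agree.\<close>
    have "at s within {0..} = at s within {0..t n}"
      by (rule at_within_nhd[of s "{..<t n}"]) (use n t_ge[of n] in auto)
    then show ?thesis
      using \<open>continuous_on {0..t n} \<xi>\<close> n t_ge[of n] that
      by (simp add: continuous_on_eq_continuous_within)
  qed
  then have "continuous_on {0..} \<xi>"
    by (simp add: continuous_on_eq_continuous_within)
  moreover have "(\<xi> has_vector_derivative A *v \<xi> s + (B ** Kc) *v \<xi> (t i)) (at s within {t i..<t (Suc i)})"
    if "s \<in> {t i..<t (Suc i)}" for s i
    by (rule has_vector_derivative_within_subset[OF deriv]) (use that in auto)
  ultimately have "sampled_solution A B Kc \<tau> \<xi> t"
    unfolding sampled_solution_def using t0 tS \<xi>_t by simp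
  with \<xi>_t show thesis
    by (intro that) (simp_all add: xs_def)
qed

text \<open>Transfers a bound along all solutions to the one-step map: take the glued solution
  through x and read the bound at i = 0. It serves both samplings, with factor a for PETC and factor
  1 for the periodic one.\<close>

lemma sampled_solution_decay:
  assumes "0 < \<delta>" and "\<And>x. \<delta> \<le> \<tau> x"
    and "\<And>\<xi> t i. sampled_solution A B Kc \<tau> \<xi> t \<Longrightarrow> W (\<xi> (t (Suc i))) \<le> c * W (\<xi> (t i))"
  shows "W (transition_mat A B Kc (\<tau> x) *v x) \<le> c * W x"
proof -
  obtain \<xi> t where \<xi>: "sampled_solution A B Kc \<tau> \<xi> t"
    "\<And>i. \<xi> (t i) = ((\<lambda>x. transition_mat A B Kc (\<tau> x) *v x) ^^ i) x"
    using sampled_solution_exists[of \<delta> \<tau>] assms(1,2) by blast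
  then show ?thesis
    using assms(3)[OF \<xi>(1), of 0] by simp
qed

subsection \<open>Traffic models\<close>

lemma V_nonneg: "pos_definite P \<Longrightarrow> 0 \<le> V P x"
  by (cases "x = 0") (auto simp: pos_definite_def V_def intro: less_imp_le)

text \<open>For j < k \<le> kbar the default alternative \<open>j = kbar\<close> is impossible, so
  minimality of k only concerns the sign of the quadratic forms.\<close>

lemma kappa_eq_iff:
  assumes "1 \<le> kbar"
  shows "kappa A B Kc h kbar Q x = k \<longleftrightarrow>
    k \<in> {1..kbar} \<and> (x \<bullet> (Nmat A B Kc h Q k *v x) > 0 \<or> k = kbar) \<and>
    (\<forall>j\<in>{1..<k}. \<not> x \<bullet> (Nmat A B Kc h Q j *v x) > 0)"
    (is "_ \<longleftrightarrow> ?R")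
proof -
  let ?S = "{k \<in> {1..kbar}. x \<bullet> (Nmat A B Kc h Q k *v x) > 0 \<or> k = kbar}"
  have "kappa A B Kc h kbar Q x = k \<longleftrightarrow> k \<in> ?S \<and> (\<forall>j\<in>?S. k \<le> j)"
    unfolding kappa_def using assms by (intro Min_eq_iff) auto
  also have "\<dots> \<longleftrightarrow> ?R"
    by (auto simp: not_less[symmetric])
  finally show ?thesis .
qed

lemma quadratic_nonpos_below_kmin:
  assumes "j \<in> {1..<kmin A B Kc h kbar Q}" "1 \<le> kbar"
  shows "\<not> x \<bullet> (Nmat A B Kc h Q j *v x) > 0"
proof -
  let ?S = "{k \<in> {1..kbar}. \<not> neg_semidefinite (Nmat A B Kc h Q k)}"
  have j: "j \<in> {1..kbar}"
    using assms kmin_in[OF assms(2), of A B Kc h Q] by auto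
  have "neg_semidefinite (Nmat A B Kc h Q j)"
  proof (rule ccontr)
    assume "\<not> neg_semidefinite (Nmat A B Kc h Q j)"
    with j have "j \<in> ?S" by simp
    then have "kmin A B Kc h kbar Q = Min ?S"
      unfolding kmin_def by (subst if_P) auto
    also have "\<dots> \<le> j"
      using \<open>j \<in> ?S\<close> by (intro Min_le) auto
    finally show False using assms by simp
  qed
  then show ?thesis
    by (auto simp: neg_semidefinite_def not_less)
qed

text \<open>A value below \<open>kmin\<close> would also be below \<open>kbar\<close>, so its
  quadratic form would be positive at x, contradicting negative semidefiniteness.\<close>

lemma kappa_in_Kset:
  assumes "1 \<le> kbar"
  shows "kappa A B Kc h kbar Q x \<in> Kset A B Kc h kbar Q"
  using kappa_eq_iff[OF assms, THEN iffD1, OF refl, of A B Kc h Q x]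
    quadratic_nonpos_below_kmin[OF _ assms, of "kappa A B Kc h kbar Q x" A B Kc h Q x]
    kmin_in[OF assms, of A B Kc h Q]
  by (fastforce simp: Kset_def not_less[symmetric])

text \<open>\<open>Q_region\<close> only removes the regions of indices from \<open>kmin\<close> on,
  whereas \<open>kappa\<close> minimises from 1; the indices in between never trigger.\<close>

lemma Q_region_iff_kappa:
  assumes "1 \<le> kbar" "x \<in> X0 P V0" "k \<in> Kset A B Kc h kbar Q"
  shows "x \<in> Q_region A B Kc h kbar Q P V0 k \<longleftrightarrow> kappa A B Kc h kbar Q x = k"
proof -
  let ?pos = "\<lambda>j. x \<bullet> (Nmat A B Kc h Q j *v x) > 0"
  let ?kmin = "kmin A B Kc h kbar Q"
  have k: "k \<in> {1..kbar}" "?kmin \<le> k"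
    using assms(3) kmin_in[OF assms(1), of A B Kc h Q] by (auto simp: Kset_def)
  have "x \<in> Q_region A B Kc h kbar Q P V0 k \<longleftrightarrow>
      (?pos k \<or> k = kbar) \<and> (\<forall>j\<in>{?kmin..<k}. \<not> ?pos j)"
    using assms(2) k by (auto simp: Q_region_def K_region_def)
  also have "(\<forall>j\<in>{?kmin..<k}. \<not> ?pos j) \<longleftrightarrow> (\<forall>j\<in>{1..<k}. \<not> ?pos j)"
    using quadratic_nonpos_below_kmin[OF _ assms(1), of _ A B Kc h Q x]
      kmin_in[OF assms(1), of A B Kc h Q]
    by (meson atLeastAtMost_iff atLeastLessThan_iff le_trans not_le)
  finally show ?thesis
    using k(1) by (simp add: kappa_eq_iff[OF assms(1)])
qed

lemma K_seqs_iff: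
  "\<sigma> \<in> K_seqs A B Kc h kbar Q N \<longleftrightarrow> length \<sigma> \<le> N \<and> set \<sigma> \<subseteq> Kset A B Kc h kbar Q"
  by (cases \<sigma>) (auto simp: K_seqs_def)

lemma run_Nil: "run A B Kc h [] x = x"
  and run_Cons: "run A B Kc h (k # \<sigma>) x = run A B Kc h \<sigma> (Mmat A B Kc h k *v x)"
  by (simp_all add: run_def)

lemma RB_Nil_iff:
  assumes "r < 1" "0 < V0"
  shows "(x, []) \<in> RB A B Kc h kbar Q P V0 r N \<longleftrightarrow> x \<in> XP P V0 r"
  using XP_subset[OF assms, of P] by (auto simp: RB_def K_seqs_iff)

text \<open>Recursive form of \<open>RB\<close>. Splitting the bounded quantifiers at i = 0 isolates
  the conditions on x, which force k to be the inter-event time; the shifted rest are the conditions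
  on the successor, whose membership in \<open>X0\<close> comes from \<open>inv\<close>.\<close>

lemma RB_Cons_iff:
  assumes "1 \<le> kbar"
    and inv: "\<And>x. x \<in> X0 P V0 \<Longrightarrow> Mmat A B Kc h (kappa A B Kc h kbar Q x) *v x \<in> X0 P V0"
  shows "(x, k # \<sigma>) \<in> RB A B Kc h kbar Q P V0 r N \<longleftrightarrow>
    x \<in> X0 P V0 \<and> x \<notin> XP P V0 r \<and> k = kappa A B Kc h kbar Q x \<and> length \<sigma> < N \<and>
    (Mmat A B Kc h k *v x, \<sigma>) \<in> RB A B Kc h kbar Q P V0 r N"
proof (cases "x \<in> X0 P V0 \<and> k = kappa A B Kc h kbar Q x")
  case True
  then have "k \<in> Kset A B Kc h kbar Q" "Mmat A B Kc h k *v x \<in> X0 P V0"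
    using kappa_in_Kset[OF assms(1)] inv by auto
  with True show ?thesis
    using Q_region_iff_kappa[OF assms(1), of x P V0 k A B Kc h Q]
    by (cases \<sigma>) (auto simp: RB_def K_seqs_iff All_less_Suc2 run_Nil run_Cons)
next
  case False
  then show ?thesis
    using Q_region_iff_kappa[OF assms(1), of x P V0 k A B Kc h Q]
    by (auto simp: RB_def K_seqs_iff All_less_Suc2 run_Nil)
qed

text \<open>Here n is a budget of steps: a step costs one factor a, and at budget 0 the bound says
  that x lies in \<open>XP\<close>. The condition \<open>n \<le> N\<close> keeps the word within the
  length allowed by \<open>K_seqs\<close>.\<close>

lemma RB_total:
  assumes "1 \<le> kbar" "r < 1" "0 < V0" "0 < a"
    and inv: "\<And>x. x \<in> X0 P V0 \<Longrightarrow> Mmat A B Kc h (kappa A B Kc h kbar Q x) *v x \<in> X0 P V0"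
    and decay: "\<And>x. V P (Mmat A B Kc h (kappa A B Kc h kbar Q x) *v x) \<le> a * V P x"
    and "x \<in> X0 P V0" "a ^ n * V P x \<le> r * V0" "n \<le> N"
  shows "\<exists>\<sigma>. length \<sigma> \<le> n \<and> (x, \<sigma>) \<in> RB A B Kc h kbar Q P V0 r N"
  using assms(7-9)
proof (induction n arbitrary: x)
  case 0
  then have "(x, []) \<in> RB A B Kc h kbar Q P V0 r N"
    by (simp add: RB_Nil_iff[OF assms(2,3)] XP_def)
  then show ?case by auto
next
  case (Suc n)
  show ?case
  proof (cases "x \<in> XP P V0 r")
    case True
    then have "(x, []) \<in> RB A B Kc h kbar Q P V0 r N"
      by (simp add: RB_Nil_iff[OF assms(2,3)])
    then show ?thesis by (intro exI[of _ "[]"]) simp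
  next
    case False
    let ?k = "kappa A B Kc h kbar Q x"
    let ?x' = "Mmat A B Kc h ?k *v x"
    have "a ^ n * V P ?x' \<le> a ^ n * (a * V P x)"
      using decay[of x] \<open>0 < a\<close> by (intro mult_left_mono) simp_all
    also have "\<dots> \<le> r * V0"
      using Suc.prems(2) by (simp add: ac_simps)
    finally obtain \<sigma> where "length \<sigma> \<le> n" "(?x', \<sigma>) \<in> RB A B Kc h kbar Q P V0 r N"
      using Suc.IH[of ?x'] inv Suc.prems by auto
    then have "(x, ?k # \<sigma>) \<in> RB A B Kc h kbar Q P V0 r N"
      using RB_Cons_iff[OF assms(1) inv] False Suc.prems by simp
    with \<open>length \<sigma> \<le> n\<close> show ?thesis by (intro exI[of _ "?k # \<sigma>"]) simp
  qed
qed

text \<open>For a base below 1, rounding the exponent up can only lower the power.\<close>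

lemma power_nat_ceiling_log_le:
  assumes "0 < a" "a < 1" "0 < r"
  shows "a ^ nat \<lceil>log a r\<rceil> \<le> r"
proof -
  have "a ^ nat \<lceil>log a r\<rceil> = a powr real (nat \<lceil>log a r\<rceil>)"
    using assms by (simp add: powr_realpow)
  also have "\<dots> \<le> a powr log a r"
    using assms by (intro powr_mono') (simp_all add: real_nat_ceiling_ge)
  also have "\<dots> = r"
    using assms by simp
  finally show ?thesis .
qed

theorem theorem1:
  fixes A :: "real^'nx^'nx"
    and B :: "real^'nu^'nx"
    and Kc :: "real^'nx^'nu"
    and Q :: "real^('nx + 'nx)^('nx + 'nx)"
    and P :: "real^'nx^'nx"
    and h hP V0 r a :: real
    and kbar N :: nat
  assumes "h > 0" and "kbar \<ge> 1" and "transpose Q = Q" and "pos_definite P"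
    and GES: "petc_GES A B Kc h kbar Q"
    and "0 < a" and "a < 1"
    and petc_decay:
      "\<And>\<xi> t i. petc_solution A B Kc h kbar Q \<xi> t \<Longrightarrow> V P (\<xi> (t (Suc i))) \<le> a * V P (\<xi> (t i))"
    and "hP > 0"
    and periodic_nonincreasing:
      "\<And>\<xi> t i. sampled_solution A B Kc (\<lambda>_. hP) \<xi> t \<Longrightarrow> V P (\<xi> (t (Suc i))) \<le> V P (\<xi> (t i))"
    and "V0 > 0"
    and "0 < r" and "r < 1"
    and "N = nat \<lceil>log a r\<rceil>"
  shows "bisimilar (S_E A B Kc h kbar Q P V0 r hP) (S_B A B Kc h kbar Q P V0 r hP N)"
proof -
  let ?\<kappa> = "kappa A B Kc h kbar Q" and ?M = "Mmat A B Kc h" and ?X0 = "X0 P V0"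
    and ?XP = "XP P V0 r" and ?XB = "XB A B Kc h kbar Q P V0 r N"
    and ?R = "RB A B Kc h kbar Q P V0 r N"
    and ?SE = "S_E A B Kc h kbar Q P V0 r hP" and ?SB = "S_B A B Kc h kbar Q P V0 r hP N"
  \<comment> \<open>Inter-event times are at least 1, so h is a uniform lower bound on the sampling
    intervals.\<close>
  have "h \<le> h * real (?\<kappa> x)" for x
    using kappa_in[OF \<open>kbar \<ge> 1\<close>, of A B Kc h Q x] \<open>h > 0\<close> by simp
  then have decay: "V P (?M (?\<kappa> x) *v x) \<le> a * V P x" for x
    unfolding Mmat_def
    using sampled_solution_decay[OF \<open>h > 0\<close>, of "\<lambda>x. h * real (?\<kappa> x)" A B Kc "V P" a x] petc_decay
    by (simp add: petc_solution_def)
  have periodic: "transition_mat A B Kc hP *v x \<in> ?XP" if "x \<in> ?XP" for x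
    using sampled_solution_decay[OF \<open>hP > 0\<close>, of "\<lambda>_. hP" A B Kc "V P" 1 x]
      periodic_nonincreasing that
    by (auto simp: XP_def intro: order_trans)
  have inv: "?M (?\<kappa> x) *v x \<in> ?X0" if "x \<in> ?X0" for x
  proof -
    have "a * V P x \<le> 1 * V P x"
      using \<open>a < 1\<close> V_nonneg[OF \<open>pos_definite P\<close>] by (intro mult_right_mono) simp_all
    then show ?thesis
      using decay[of x] that by (simp add: X0_def)
  qed
  have RB_Cons: "(x, k # \<sigma>) \<in> ?R \<longleftrightarrow>
      x \<in> ?X0 \<and> x \<notin> ?XP \<and> k = ?\<kappa> x \<and> length \<sigma> < N \<and> (?M k *v x, \<sigma>) \<in> ?R" for x k \<sigma>
    by (rule RB_Cons_iff[OF \<open>kbar \<ge> 1\<close> inv])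
  have RB_Nil: "(x, []) \<in> ?R \<longleftrightarrow> x \<in> ?XP" for x
    by (rule RB_Nil_iff) fact+
  have total: "\<exists>\<sigma>. (x, \<sigma>) \<in> ?R" if "x \<in> ?X0" for x
  proof -
    \<comment> \<open>The bound on \<open>V\<close> over \<open>X0\<close> meets the choice of
      \<open>N\<close>: the full budget \<open>N\<close> suffices from every initial state.\<close>
    have "a ^ N * V P x \<le> r * V0"
      using power_nat_ceiling_log_le[OF \<open>0 < a\<close> \<open>a < 1\<close> \<open>0 < r\<close>] that \<open>N = _\<close> \<open>0 < r\<close>
        V_nonneg[OF \<open>pos_definite P\<close>]
      by (intro mult_mono) (simp_all add: X0_def)
    then show ?thesis
      using RB_total[OF \<open>kbar \<ge> 1\<close> \<open>r < 1\<close> \<open>V0 > 0\<close> \<open>0 < a\<close> inv decay that] by blast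
  qed
  have R_sub: "?R \<subseteq> ?X0 \<times> ?XB"
    by (auto simp: RB_def XB_def)
  have out: "outmap ?SE x = outmap ?SB \<sigma>" if "(x, \<sigma>) \<in> ?R" for x \<sigma>
    using that by (cases \<sigma>) (auto simp: S_E_def S_B_def RB_Nil RB_Cons)
  \<comment> \<open>In \<open>XP\<close> only the periodic transition is possible and it stays in
    \<open>XP\<close>, matching the loop at the empty word. Outside, the successor is determined by
    \<open>kappa\<close> and is related to the tail of the word.\<close>
  have E_B: "\<exists>\<sigma>'. (\<sigma>, \<sigma>') \<in> transitions ?SB \<and> (x', \<sigma>') \<in> ?R"
    if "(x, \<sigma>) \<in> ?R" "(x, x') \<in> transitions ?SE" for x \<sigma> x'
  proof (cases \<sigma>)
    case Nil
    then have "(x', []) \<in> ?R"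
      using that by (auto simp: RB_Nil S_E_def E_petc_def E_per_def)
    then show ?thesis
      using that(1) R_sub Nil by (intro exI[of _ "[]"]) (auto simp: S_B_def)
  next
    case (Cons k \<sigma>')
    then have "x \<notin> ?XP" "k = ?\<kappa> x" "(?M k *v x, \<sigma>') \<in> ?R"
      using that(1) by (auto simp: RB_Cons)
    then show ?thesis
      using that R_sub Cons kappa_in_Kset[OF \<open>kbar \<ge> 1\<close>, of A B Kc h Q x]
      by (intro exI[of _ \<sigma>']) (auto simp: S_E_def S_B_def E_petc_def E_per_def)
  qed
  \<comment> \<open>Dropping the first letter k is answered by the event-triggered step, as k is the
    inter-event time of x; the loop at the empty word is answered by a periodic step, which stays in
    \<open>XP\<close>.\<close>
  have B_E: "\<exists>x'. (x, x') \<in> transitions ?SE \<and> (x', \<sigma>') \<in> ?R"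
    if "(x, \<sigma>) \<in> ?R" "(\<sigma>, \<sigma>') \<in> transitions ?SB" for x \<sigma> \<sigma>'
    using that(2) unfolding S_B_def
  proof (clarsimp, elim disjE bexE conjE)
    fix k assume "\<sigma> = k # \<sigma>'"
    with that(1) show ?thesis
      using inv by (intro exI[of _ "?M k *v x"]) (auto simp: S_E_def E_petc_def RB_Cons)
  next
    assume "\<sigma> = []" "\<sigma>' = []"
    with that(1) show ?thesis
      using periodic
      by (intro exI[of _ "transition_mat A B Kc hP *v x"]) (auto simp: S_E_def E_per_def RB_Nil)
  qed
  have "simulation_relation ?R ?SE ?SB"
    unfolding simulation_relation_def
    using R_sub total out E_B by (fastforce simp: S_E_def S_B_def)
  \<comment> \<open>Each initial word has a related state by the very definition of
    \<open>XB\<close>.\<close>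
  moreover have "simulation_relation (?R\<inverse>) ?SB ?SE"
    unfolding simulation_relation_def
    using R_sub out B_E by (fastforce simp: S_E_def S_B_def XB_def)
  moreover have "outputs ?SE = outputs ?SB"
    by (simp add: S_E_def S_B_def)
  ultimately show ?thesis
    unfolding bisimilar_def by blast
qed

end
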